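(* Let $V_i(z)=\sum_{j=1}^{m_i}[g_{i,j}(z)]_+^2$ with continuously differentiable $g_{i,j}$. If $g_{i,j}(z)=0$, then $$\nabla\bigl([g_{i,j}(z)]_+^2\bigr)=2[g_{i,j}(z)]_+\nabla g_{i,j}(z)=0.$$ In particular, $\nabla V_i(z^\star_{\mathrm{lex}})=0$ whenever $V_i^\star=0$.
   Context: Let $L\ge1$, $m_1,\dots,m_L\ge1$, $d\ge1$ be integers. $\mathcal Z\subset\mathbb R^d$ is the feasible set, $J:\mathbb R^d\to\mathbb R$ the performance objective, $g_{i,j}:\mathbb R^d\to\mathbb R$ ($1\le i\le L$, $1\le j\le m_i$) constraint functions, and $[a]_+=\max(0,a)$. Standing assumptions: $\mathcal Z$ is compact and convex, all $g_{i,j}$ and $J$ are convex, the minima below are attained, weighted-sum minimizers of $J+\sum_iw_iV_i$ over $\mathcal Z$ exist for all $w\in(0,\infty)^L$, and the lexicographic optimum is unique. Lexicographic cascade: $\mathcal F_0=\mathcal Z$, and for $i=1,\dots,L$, $V_i^\star=\min_{z\in\mathcal F_{i-1}}V_i(z)$, $\mathcal F_i=\{z\in\mathcal F_{i-1}:V_i(z)=V_i^\star\}$. The lexicographic optimum $z^\star_{\mathrm{lex}}$ is the minimizer of $J$ over $\mathcal F_L$. *)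

theory Defs
  imports "HOL-Analysis.Analysis"
begin

definition violation ::
  "(nat \<Rightarrow> nat) \<Rightarrow> (nat \<Rightarrow> nat \<Rightarrow> 'a \<Rightarrow> real) \<Rightarrow> nat \<Rightarrow> 'a \<Rightarrow> real"
  where "violation m g i z = (\<Sum>j=1..m i. (max 0 (g i j z))\<^sup>2)"

text \<open>The minimum of a function over a set is the least element of its image. The value is
  meaningful only if the minimum is attained.\<close>

definition min_value :: "('a \<Rightarrow> real) \<Rightarrow> 'a set \<Rightarrow> real"
  where "min_value f S = (LEAST v. v \<in> f ` S)"

fun lex_feasible :: "'a set \<Rightarrow> (nat \<Rightarrow> 'a \<Rightarrow> real) \<Rightarrow> nat \<Rightarrow> 'a set"
  where
    "lex_feasible Z V 0 = Z"
  | "lex_feasible Z V (Suc i) =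
       {z \<in> lex_feasible Z V i. V (Suc i) z = min_value (V (Suc i)) (lex_feasible Z V i)}"

text \<open>Levels are numbered from 1, so that \<open>i - 1\<close> is used only for \<open>i \<ge> 1\<close>.\<close>

definition lex_value :: "'a set \<Rightarrow> (nat \<Rightarrow> 'a \<Rightarrow> real) \<Rightarrow> nat \<Rightarrow> real"
  where "lex_value Z V i = min_value (V i) (lex_feasible Z V (i - 1))"

text \<open>Defined by choice; it is the lexicographic optimum when the minimizer exists and is unique.\<close>

definition lex_opt ::
  "'a set \<Rightarrow> (nat \<Rightarrow> 'a \<Rightarrow> real) \<Rightarrow> ('a \<Rightarrow> real) \<Rightarrow> nat \<Rightarrow> 'a"
  where "lex_opt Z V J L = arg_min_on J (lex_feasible Z V L)"

end

theory Submission
  imports Defs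
begin

text \<open>The gradient formula follows from the chain rule, because the scalar function
  \<open>t \<mapsto> (max 0 t)\<^sup>2\<close> is differentiable on the whole line with derivative \<open>2 * max 0 t\<close>: the kink of
  \<open>max 0\<close> at the origin is flattened by squaring. The formula therefore holds at every point, and
  where a constraint function is nonpositive it yields a zero gradient.

  A violation is a sum of squares, so at a point where it vanishes every summand vanishes and hence
  every summand has gradient zero. The lexicographic optimum is such a point for each level of
  optimal value zero: it lies in the last feasible set because a
  minimizer of \<open>J\<close> there exists, the feasible sets decrease, and membership
  in the feasible set of level \<open>i\<close> forces the \<open>i\<close>-th violation to equal its
  optimal value.\<close>

text \<open>The error of the linear approximation is bounded by the square of the increment, whichever side
  of the origin the two points lie on, so that a single limit argument gives the derivative at every
  point, the kink at the origin included.\<close>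

lemma pos_part_square_linearization:
  fixes t h :: real
  shows "\<bar>(max 0 (t + h))\<^sup>2 - (max 0 t)\<^sup>2 - 2 * max 0 t * h\<bar> \<le> h\<^sup>2"
proof -
  consider "0 \<le> t" "0 \<le> t + h" | "0 \<le> t" "t + h < 0" | "t < 0" "0 \<le> t + h" | "t < 0" "t + h < 0"
    by linarith
  then show ?thesis
  proof cases
    case 1
    then show ?thesis by (simp add: power2_eq_square algebra_simps)
  next
    case 2
    \<comment> \<open>The quantity inside the absolute value is \<open>- t * (t + 2 * h)\<close>, or \<open>h\<^sup>2 - (t + h)\<^sup>2\<close>.\<close>
    have "0 \<le> (t + h)\<^sup>2" by simp
    moreover have "t * (t + 2 * h) \<le> 0"
      using 2 by (intro mult_nonneg_nonpos) auto
    ultimately show ?thesis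
      using 2 by (simp add: power2_eq_square algebra_simps)
  next
    case 3
    then have "(t + h)\<^sup>2 \<le> h\<^sup>2" by (intro power_mono) auto
    with 3 show ?thesis by simp
  next
    case 4
    then show ?thesis by simp
  qed
qed

lemma DERIV_pos_part_square:
  fixes t :: real
  shows "DERIV (\<lambda>s. (max 0 s)\<^sup>2) t :> 2 * max 0 t"
proof -
  let ?q = "\<lambda>h. ((max 0 (t + h))\<^sup>2 - (max 0 t)\<^sup>2) / h"
  have bound: "norm (?q h - 2 * max 0 t) \<le> \<bar>h\<bar>" if "h \<noteq> 0" for h
  proof -
    have "?q h - 2 * max 0 t = ((max 0 (t + h))\<^sup>2 - (max 0 t)\<^sup>2 - 2 * max 0 t * h) / h"
      using that by (simp add: diff_divide_distrib)
    then have "norm (?q h - 2 * max 0 t) \<le> h\<^sup>2 / \<bar>h\<bar>"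
      using pos_part_square_linearization[of t h] by (simp add: divide_right_mono)
    also have "\<dots> = \<bar>h\<bar>"
      using that by (simp add: field_simps flip: power2_eq_square)
    finally show ?thesis .
  qed
  have "((\<lambda>h. ?q h - 2 * max 0 t) \<longlongrightarrow> 0) (at 0)"
  proof (rule Lim_null_comparison)
    show "\<forall>\<^sub>F h in at 0. norm (?q h - 2 * max 0 t) \<le> \<bar>h\<bar>"
      using bound by (auto simp: eventually_at_filter)
    show "((\<lambda>h::real. \<bar>h\<bar>) \<longlongrightarrow> 0) (at 0)"
      by (intro tendsto_rabs_zero tendsto_ident_at)
  qed
  then show ?thesis
    unfolding DERIV_def by (rule LIM_zero_cancel)
qed

lemma GDERIV_pos_part_square:
  assumes "GDERIV f z :> df"
  shows "GDERIV (\<lambda>y. (max 0 (f y))\<^sup>2) z :> (2 * max 0 (f z)) *\<^sub>R df"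
  by (rule GDERIV_DERIV_compose[OF assms DERIV_pos_part_square])

lemma GDERIV_sum:
  assumes "\<And>j. j \<in> A \<Longrightarrow> GDERIV (f j) z :> df j"
  shows "GDERIV (\<lambda>y. \<Sum>j\<in>A. f j y) z :> (\<Sum>j\<in>A. df j)"
  using assms by (induction A rule: infinite_finite_induct) (auto intro: GDERIV_const GDERIV_add)

lemma violation_eq_0_iff:
  "violation m g i z = 0 \<longleftrightarrow> (\<forall>j\<in>{1..m i}. max 0 (g i j z) = 0)"
  by (simp add: violation_def sum_nonneg_eq_0_iff)

lemma GDERIV_violation:
  assumes "\<And>j. j \<in> {1..m i} \<Longrightarrow> GDERIV (g i j) z :> dg j"
  shows "GDERIV (violation m g i) z :> (\<Sum>j=1..m i. (2 * max 0 (g i j z)) *\<^sub>R dg j)"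
  unfolding violation_def[abs_def] using assms by (intro GDERIV_sum GDERIV_pos_part_square)

lemma GDERIV_violation_eq_0:
  assumes "\<And>j. j \<in> {1..m i} \<Longrightarrow> GDERIV (g i j) z :> dg j"
    and "violation m g i z = 0"
  shows "GDERIV (violation m g i) z :> 0"
proof -
  have "(\<Sum>j=1..m i. (2 * max 0 (g i j z)) *\<^sub>R dg j) = 0"
    using assms(2) by (intro sum.neutral) (simp add: violation_eq_0_iff)
  then show ?thesis
    using GDERIV_violation[of m i g z dg] assms(1) by simp
qed

lemma antimono_lex_feasible: "antimono (lex_feasible Z V)"
  by (rule antimono_iff_le_Suc[THEN iffD2]) auto

lemma lex_feasible_value:
  assumes "z \<in> lex_feasible Z V L" and "i \<in> {1..L}"
  shows "V i z = lex_value Z V i"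
proof -
  have "z \<in> lex_feasible Z V i"
    using antimonoD[OF antimono_lex_feasible, of i L Z V] assms by auto
  with assms(2) show ?thesis
    by (cases i) (auto simp: lex_value_def)
qed

lemma lex_opt_feasible:
  assumes "\<exists>z. is_arg_min J (\<lambda>z. z \<in> lex_feasible Z V L) z"
  shows "lex_opt Z V J L \<in> lex_feasible Z V L"
proof -
  have "is_arg_min J (\<lambda>z. z \<in> lex_feasible Z V L) (lex_opt Z V J L)"
    unfolding lex_opt_def arg_min_on_def arg_min_def using assms by (rule someI_ex)
  then show ?thesis
    by (simp add: is_arg_min_def)
qed

theorem mainTheorem5:
  fixes L :: nat
    and m :: "nat \<Rightarrow> nat"
    and Z :: "(real ^ 'd) set"
    and J :: "real ^ 'd \<Rightarrow> real"
    and g :: "nat \<Rightarrow> nat \<Rightarrow> real ^ 'd \<Rightarrow> real"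
    and grad_g :: "nat \<Rightarrow> nat \<Rightarrow> real ^ 'd \<Rightarrow> real ^ 'd"
    and V :: "nat \<Rightarrow> real ^ 'd \<Rightarrow> real"
  defines "V \<equiv> violation m g"
  assumes "L \<ge> 1"
    and "\<forall>i\<in>{1..L}. m i \<ge> 1"
    and "compact Z" and "convex Z"
    and "convex_on UNIV J"
    and "\<forall>i\<in>{1..L}. \<forall>j\<in>{1..m i}. convex_on UNIV (g i j)"
    and "\<forall>i\<in>{1..L}. \<forall>j\<in>{1..m i}.
           (\<forall>z. GDERIV (g i j) z :> grad_g i j z) \<and> continuous_on UNIV (grad_g i j)"
    and "\<forall>i\<in>{1..L}. \<exists>z. is_arg_min (V i) (\<lambda>z. z \<in> lex_feasible Z V (i - 1)) z"
    and "\<forall>w :: nat \<Rightarrow> real. (\<forall>i\<in>{1..L}. w i > 0) \<longrightarrow>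
           (\<exists>z. is_arg_min (\<lambda>z. J z + (\<Sum>i=1..L. w i * V i z)) (\<lambda>z. z \<in> Z) z)"
    and "\<exists>!z. is_arg_min J (\<lambda>z. z \<in> lex_feasible Z V L) z"
  shows "(\<forall>i\<in>{1..L}. \<forall>j\<in>{1..m i}. \<forall>z. g i j z = 0 \<longrightarrow>
            (GDERIV (\<lambda>y. (max 0 (g i j y))\<^sup>2) z :> (2 * max 0 (g i j z)) *\<^sub>R grad_g i j z) \<and>
            (2 * max 0 (g i j z)) *\<^sub>R grad_g i j z = 0) \<and>
         (\<forall>i\<in>{1..L}. lex_value Z V i = 0 \<longrightarrow> (GDERIV (V i) (lex_opt Z V J L) :> 0))"
proof (intro conjI ballI allI impI)
  fix i j z
  assume ij: "i \<in> {1..L}" "j \<in> {1..m i}" and zero: "g i j z = 0"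
  show "GDERIV (\<lambda>y. (max 0 (g i j y))\<^sup>2) z :> (2 * max 0 (g i j z)) *\<^sub>R grad_g i j z"
    using assms(8) ij by (intro GDERIV_pos_part_square) blast
  show "(2 * max 0 (g i j z)) *\<^sub>R grad_g i j z = 0"
    using zero by simp
next
  fix i
  assume i: "i \<in> {1..L}" and zero: "lex_value Z V i = 0"
  let ?z = "lex_opt Z V J L"
  have "?z \<in> lex_feasible Z V L"
    using assms(11) by (intro lex_opt_feasible) blast
  then have "V i ?z = 0"
    using i zero by (simp add: lex_feasible_value)
  then show "GDERIV (V i) ?z :> 0"
    unfolding V_def using assms(8) i
    by (intro GDERIV_violation_eq_0[where dg = "\<lambda>j. grad_g i j (lex_opt Z (violation m g) J L)"]) auto
qed

end
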